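(* Suppose $g$ is continuously differentiable, strongly convex with constant $\eta_g>0$, and $\nabla_\theta g$ is Lipschitz continuous with constant $G_g$. Suppose there is a constant $L_{f,\theta}$ with $|f(x,\theta_1)-f(x,\theta_2)|\le L_{f,\theta}\|\theta_1-\theta_2\|$ for all $\theta_1,\theta_2\in\Theta$, $x\in X$. Let $\gamma_{g,k}=\gamma_g$ for all $k$ with $0<\gamma_g<2/G_g$, let $\{(x_k,\theta_k)\}$ be generated by the joint subgradient scheme, and suppose there is $M>0$ such that $\|d\|\le M$ for all $d\in\partial f(x_k,\theta_k)$ and all $k$. Define $$\bar x_k=\frac{\sum_{i=0}^k\gamma_{f,i}x_i}{\sum_{i=0}^k\gamma_{f,i}}.$$ Let $\theta^*$ be the minimizer of $g$ over $\Theta$ and $x^*\in X^*=\operatorname{argmin}_{x\in X}f(x,\theta^* )$. Then: (i) If $\{\gamma_{f,k}\}$ is a diminishing nonnegative sequence with $\sum_{k=1}^\infty\gamma_{f,k}=\infty$ and $\sum_{k=1}^\infty\gamma_{f,k}^2<\infty$, then $\lim_{k\to\infty}|f(\bar x_k,\theta_k)-f(x^*,\theta^* )|=0$. (ii) Suppose the scheme is terminated after $K$ iterations and uses the constant steplength $\gamma_{f,k}=\gamma_{f,K}^{\mathrm{opt}}:=\frac{\|x_0-x^*\|}{M\sqrt{K+1}}$ for all $k$. Then $$|f(\bar x_K,\theta_K)-f(x^*,\theta^* )|\le\frac{d_x}{\sqrt{K+1}}+\|\theta_0-\theta^*\|\left(L_{f,\theta}\,q_g^K+\frac{c_\theta}{K+1}\right),$$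 where $d_x=M\|x_0-x^*\|$ and $c_\theta=2L_{f,\theta}/(1-q_g)$.
   Context: $X\subseteq\mathbb{R}^n$ and $\Theta\subseteq\mathbb{R}^m$ are nonempty closed convex sets, $f:X\times\Theta\to\mathbb{R}$ is convex (not necessarily differentiable) in $x$ for every $\theta\in\Theta$, and $g:\mathbb{R}^m\to\mathbb{R}$ is convex. $X^*$ is assumed nonempty. $\partial f(x,\theta)$ denotes the subdifferential of the convex function $f(\cdot,\theta)$ at $x$; $\Pi_Y$ denotes Euclidean projection onto $Y$. A differentiable function $h$ is strongly convex with constant $\eta$ if $(\nabla h(u)-\nabla h(v))^T(u-v)\ge\eta\|u-v\|^2$ for all $u,v$. The contraction factor of the learning process is $q_g=(1-\gamma_g\eta_g(2-\gamma_gG_g))^{1/2}<1$. "Diminishing" means tending to $0$. The average $\bar x_k$ is defined whenever $\sum_{i=0}^k\gamma_{f,i}>0$. The joint subgradient scheme, given $x_0\in X$, $\theta_0\in\Theta$ and steplengths, is: for all $k\ge0$, $x_{k+1}=\Pi_X(x_k-\gamma_{f,k}d_k)$ with $d_k\in\partial f(x_k,\theta_k)$, and $\theta_{k+1}=\Pi_\Theta(\theta_k-\gamma_{g,k}\nabla_\theta g(\theta_k))$. *)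

theory Defs
  imports "HOL-Analysis.Analysis"
begin

text \<open>Subdifferential at \<open>x\<close> of a convex function whose domain is \<open>X\<close>: the subgradient
  inequality is required at the points of \<open>X\<close> only, since the function has no values elsewhere.\<close>

definition subdifferential :: "'a::euclidean_space set \<Rightarrow> ('a \<Rightarrow> real) \<Rightarrow> 'a \<Rightarrow> 'a set" where
  "subdifferential X h x = {d. \<forall>y\<in>X. h y \<ge> h x + d \<bullet> (y - x)}"

text \<open>Meaningful only where \<open>h\<close> is differentiable; unspecified elsewhere.\<close>

definition gradient :: "('a::euclidean_space \<Rightarrow> real) \<Rightarrow> 'a \<Rightarrow> 'a" where
  "gradient h u = (THE D. GDERIV h u :> D)"

definition continuously_differentiable :: "('a::euclidean_space \<Rightarrow> real) \<Rightarrow> bool" where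
  "continuously_differentiable h \<longleftrightarrow>
     (\<forall>u. h differentiable (at u)) \<and> continuous_on UNIV (gradient h)"

definition strongly_convex :: "real \<Rightarrow> ('a::euclidean_space \<Rightarrow> real) \<Rightarrow> bool" where
  "strongly_convex \<eta> h \<longleftrightarrow>
     (\<forall>u. h differentiable (at u)) \<and>
     (\<forall>u v. (gradient h u - gradient h v) \<bullet> (u - v) \<ge> \<eta> * (norm (u - v))\<^sup>2)"

text \<open>\<open>I\<close> is the set of iterations that are carried out: \<open>UNIV\<close> for an infinite run, \<open>{..K}\<close> for a
  run that is stopped at iteration \<open>K\<close>. The Euclidean projection onto a nonempty closed convex set
  is \<open>closest_point\<close>.\<close>

definition joint_subgradient_scheme ::
  "'a::euclidean_space set \<Rightarrow> 'b::euclidean_space set \<Rightarrow> ('a \<Rightarrow> 'b \<Rightarrow> real) \<Rightarrow> ('b \<Rightarrow> real)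
    \<Rightarrow> (nat \<Rightarrow> real) \<Rightarrow> (nat \<Rightarrow> real) \<Rightarrow> nat set \<Rightarrow> (nat \<Rightarrow> 'a) \<Rightarrow> (nat \<Rightarrow> 'b) \<Rightarrow> bool" where
  "joint_subgradient_scheme X \<Theta> f g \<gamma>f \<gamma>g I x \<theta> \<longleftrightarrow>
     x 0 \<in> X \<and> \<theta> 0 \<in> \<Theta> \<and>
     (\<forall>k\<in>I.
        (\<exists>d \<in> subdifferential X (\<lambda>y. f y (\<theta> k)) (x k).
           x (Suc k) = closest_point X (x k - \<gamma>f k *\<^sub>R d)) \<and>
        \<theta> (Suc k) = closest_point \<Theta> (\<theta> k - \<gamma>g k *\<^sub>R gradient g (\<theta> k)))"

text \<open>Defined only if the weights sum to a positive number; otherwise the library convention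
  \<open>inverse 0 = 0\<close> gives the junk value \<open>0\<close>.\<close>

definition weighted_average :: "(nat \<Rightarrow> real) \<Rightarrow> (nat \<Rightarrow> 'a::real_vector) \<Rightarrow> nat \<Rightarrow> 'a" where
  "weighted_average \<gamma> x k = (\<Sum>i\<le>k. \<gamma> i *\<^sub>R x i) /\<^sub>R (\<Sum>i\<le>k. \<gamma> i)"

definition contraction_factor :: "real \<Rightarrow> real \<Rightarrow> real \<Rightarrow> real" where
  "contraction_factor \<gamma> \<eta> G = sqrt (1 - \<gamma> * \<eta> * (2 - \<gamma> * G))"

end

theory Submission
  imports Defs
begin

text \<open>
  Cocoercivity of \<open>\<nabla>g\<close> and nonexpansiveness of the projection make the learning step a
  contraction with factor \<open>q\<^sub>g\<close>, so \<open>\<theta>\<^sub>k\<close> converges geometrically to \<open>\<theta>*\<close>. In the usual telescoping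
  of \<open>\<parallel>x\<^sub>k - x*\<parallel>\<^sup>2\<close>, replacing \<open>f(\<cdot>, \<theta>\<^sub>k)\<close> by \<open>f(\<cdot>, \<theta>*)\<close> costs at most
  \<open>2 L \<parallel>\<theta>\<^sub>k - \<theta>*\<parallel>\<close> per step, which is summable. The remaining error of the averaged iterate is then
  controlled by Jensen's inequality from above and by the minimality of \<open>x*\<close> from below.
\<close>

section \<open>Gradients and directional derivatives\<close>

lemma GDERIV_gradient:
  fixes h :: "'a::euclidean_space \<Rightarrow> real"
  assumes "h differentiable (at u)"
  shows "GDERIV h u :> gradient h u"
proof -
  obtain D where D: "(h has_derivative D) (at u)"
    using assms by (auto simp: differentiable_def)
  have lin: "linear D" using D by (rule has_derivative_linear)
  \<comment> \<open>Riesz representation: the adjoint maps the scalar 1 to the vector representing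
    \<open>D\<close>. Its uniqueness makes the \<open>THE\<close> in \<open>gradient\<close> well
    defined.\<close>
  have "D = (\<lambda>z. z \<bullet> adjoint D 1)"
    using adjoint_works[OF lin, of _ 1] by (auto simp: fun_eq_iff)
  then have ex: "GDERIV h u :> adjoint D 1"
    using D unfolding gderiv_def by simp
  moreover have "E = adjoint D 1" if "GDERIV h u :> E" for E
  proof -
    have "(\<lambda>z. z \<bullet> E) = (\<lambda>z. z \<bullet> adjoint D 1)"
      using that ex unfolding gderiv_def by (rule has_derivative_unique)
    then show ?thesis by (simp add: fun_eq_iff vector_eq_ldot)
  qed
  ultimately show ?thesis unfolding gradient_def by (rule theI)
qed

lemma DERIV_along_line:
  fixes h :: "'a::real_inner \<Rightarrow> real"
  assumes "GDERIV h (u + t *\<^sub>R d) :> D"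
  shows "((\<lambda>s. h (u + s *\<^sub>R d)) has_real_derivative d \<bullet> D) (at t)"
proof -
  have "((\<lambda>s. u + s *\<^sub>R d) has_derivative (\<lambda>s. s *\<^sub>R d)) (at t)"
    by (auto intro!: derivative_eq_intros)
  from has_derivative_compose[OF this assms[unfolded gderiv_def]]
  show ?thesis by (simp add: has_field_derivative_def mult_commute_abs)
qed

section \<open>Cocoercivity and contraction of gradient steps\<close>

text \<open>Cocoercivity rests on monotonicity and the Lipschitz bound alone; strong monotonicity
  enters later, at a single pair of points.\<close>

locale monotone_lipschitz_gradient =
  fixes h :: "'a::euclidean_space \<Rightarrow> real" and h' :: "'a \<Rightarrow> 'a" and G :: real
  assumes grad: "\<And>u. GDERIV h u :> h' u"
    and mono: "\<And>u v. (h' u - h' v) \<bullet> (u - v) \<ge> 0"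
    and lip: "\<And>u v. norm (h' u - h' v) \<le> G * norm (u - v)"
begin

text \<open>Along the ray in direction \<open>d\<close>, subtracting the linearization at
  \<open>u\<close> leaves a function whose derivative is nonnegative by monotonicity.\<close>

lemma gradient_inequality: "h u + d \<bullet> h' u \<le> h (u + d)"
proof -
  let ?\<phi> = "\<lambda>t. h (u + t *\<^sub>R d) - t * (d \<bullet> h' u)"
  have "?\<phi> 0 \<le> ?\<phi> 1"
  proof (rule DERIV_nonneg_imp_nondecreasing[where f = ?\<phi>])
    fix t :: real assume t: "0 \<le> t"
    have "(?\<phi> has_real_derivative d \<bullet> h' (u + t *\<^sub>R d) - d \<bullet> h' u) (at t)"
      by (rule derivative_eq_intros DERIV_along_line grad | simp)+
    \<comment> \<open>Monotonicity gives this inequality multiplied by \<open>t\<close>, hence the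
      separate case \<open>t = 0\<close>.\<close>
    moreover have "d \<bullet> h' (u + t *\<^sub>R d) - d \<bullet> h' u \<ge> 0"
    proof (cases "t = 0")
      case False
      then show ?thesis
        using mono[of "u + t *\<^sub>R d" u] t by (auto simp: inner_diff inner_commute zero_le_mult_iff)
    qed simp
    ultimately show "\<exists>y. (?\<phi> has_real_derivative y) (at t) \<and> 0 \<le> y" by blast
  qed simp
  then show ?thesis by simp
qed

text \<open>By Cauchy-Schwarz and the Lipschitz bound, the slope along the ray exceeds its initial
  value by at most \<open>G * (norm d)\<^sup>2 * t\<close>; the subtracted quadratic compensates
  exactly this growth.\<close>

lemma descent_inequality: "h (u + d) \<le> h u + d \<bullet> h' u + G / 2 * (norm d)\<^sup>2"
proof -
  let ?\<phi> = "\<lambda>t. h (u + t *\<^sub>R d) - t * (d \<bullet> h' u) - G / 2 * (norm d)\<^sup>2 * t\<^sup>2"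
  have "?\<phi> 1 \<le> ?\<phi> 0"
  proof (rule DERIV_nonpos_imp_nonincreasing[where f = ?\<phi>])
    fix t :: real assume t: "0 \<le> t"
    have "(?\<phi> has_real_derivative
        d \<bullet> h' (u + t *\<^sub>R d) - d \<bullet> h' u - G * (norm d)\<^sup>2 * t) (at t)"
      by (rule derivative_eq_intros DERIV_along_line grad | simp)+
    moreover have "d \<bullet> h' (u + t *\<^sub>R d) - d \<bullet> h' u \<le> G * (norm d)\<^sup>2 * t"
    proof -
      have "d \<bullet> (h' (u + t *\<^sub>R d) - h' u) \<le> norm d * norm (h' (u + t *\<^sub>R d) - h' u)"
        by (rule norm_cauchy_schwarz)
      also have "\<dots> \<le> norm d * (G * norm (t *\<^sub>R d))"
        using lip[of "u + t *\<^sub>R d" u] by (intro mult_left_mono) auto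
      finally show ?thesis
        using t by (simp add: inner_diff power2_eq_square mult_ac)
    qed
    ultimately show "\<exists>y. (?\<phi> has_real_derivative y) (at t) \<and> y \<le> 0" by force
  qed simp
  then show ?thesis by simp
qed

text \<open>The function \<open>h - \<langle>h' u, \<cdot>\<rangle>\<close> is minimal at \<open>u\<close>; compare with a gradient step from \<open>v\<close>.\<close>

lemma gradient_inequality_sharp:
  assumes "G > 0"
  shows "h u + (v - u) \<bullet> h' u + (norm (h' v - h' u))\<^sup>2 / (2 * G) \<le> h v"
proof -
  define D where "D = h' v - h' u"
  \<comment> \<open>This \<open>w\<close> minimizes
    \<open>w \<bullet> D + G / 2 * (norm w)\<^sup>2\<close>, the bound on the change of the tilted
    function away from \<open>v\<close>.\<close>
  define w where "w = - (1 / G) *\<^sub>R D"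
  have "h u + (v + w - u) \<bullet> h' u \<le> h (v + w)"
    using gradient_inequality[of u "v + w - u"] by simp
  also have "\<dots> \<le> h v + w \<bullet> h' v + G / 2 * (norm w)\<^sup>2"
    by (rule descent_inequality)
  also have "G / 2 * (norm w)\<^sup>2 = (norm D)\<^sup>2 / (2 * G)"
    using assms by (simp add: w_def power_divide power2_eq_square)
  finally have "h u + (v - u) \<bullet> h' u \<le> h v + w \<bullet> D + (norm D)\<^sup>2 / (2 * G)"
    by (simp add: D_def inner_diff inner_add)
  also have "w \<bullet> D = - ((norm D)\<^sup>2 / G)"
    by (simp add: w_def power2_norm_eq_inner)
  finally show ?thesis using assms by (simp add: D_def field_simps)
qed

text \<open>Adding the sharp inequality for \<open>(u, v)\<close> and for \<open>(v, u)\<close>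
  cancels the function values.\<close>

lemma cocoercive:
  assumes "G > 0"
  shows "(norm (h' u - h' v))\<^sup>2 \<le> G * ((h' u - h' v) \<bullet> (u - v))"
proof -
  have "(norm (h' u - h' v))\<^sup>2 / G \<le> (h' u - h' v) \<bullet> (u - v)"
    using gradient_inequality_sharp[OF assms, of u v] gradient_inequality_sharp[OF assms, of v u] assms
    by (simp add: norm_minus_commute[of "h' v"] inner_diff inner_commute field_simps)
  then show ?thesis using assms by (simp add: field_simps)
qed

text \<open>Expanding the square leaves a quadratic term in the gradient difference; cocoercivity
  absorbs it into the inner product, to which strong monotonicity applies.\<close>

lemma gradient_step_contraction:
  assumes "G > 0" "0 < \<gamma>" "\<gamma> < 2 / G"
    and strong: "(h' u - h' v) \<bullet> (u - v) \<ge> \<eta> * (norm (u - v))\<^sup>2"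
  shows "norm ((u - \<gamma> *\<^sub>R h' u) - (v - \<gamma> *\<^sub>R h' v)) \<le> contraction_factor \<gamma> \<eta> G * norm (u - v)"
proof -
  define e D where "e = u - v" and "D = h' u - h' v"
  have "(norm (e - \<gamma> *\<^sub>R D))\<^sup>2 = (norm e)\<^sup>2 - 2 * \<gamma> * (D \<bullet> e) + \<gamma>\<^sup>2 * (norm D)\<^sup>2"
    unfolding power2_norm_eq_inner
    by (simp add: inner_diff inner_commute power2_eq_square algebra_simps)
  also have "\<dots> \<le> (norm e)\<^sup>2 - 2 * \<gamma> * (D \<bullet> e) + \<gamma>\<^sup>2 * (G * (D \<bullet> e))"
    using cocoercive[OF assms(1), of u v] by (simp add: D_def e_def mult_left_mono)
  also have "\<dots> = (norm e)\<^sup>2 - \<gamma> * (2 - \<gamma> * G) * (D \<bullet> e)"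
    by (simp add: algebra_simps power2_eq_square)
  \<comment> \<open>The condition \<open>\<gamma> < 2 / G\<close> makes the coefficient of the inner
    product negative, so a lower bound on the inner product bounds the expression from
    above.\<close>
  also have "\<dots> \<le> (norm e)\<^sup>2 - \<gamma> * (2 - \<gamma> * G) * (\<eta> * (norm e)\<^sup>2)"
    using strong assms(1-3) unfolding D_def e_def
    by (intro diff_left_mono mult_left_mono) (auto simp: field_simps)
  also have "\<dots> = (1 - \<gamma> * \<eta> * (2 - \<gamma> * G)) * (norm e)\<^sup>2"
    by (simp add: algebra_simps)
  finally have "norm (e - \<gamma> *\<^sub>R D) \<le> sqrt ((1 - \<gamma> * \<eta> * (2 - \<gamma> * G)) * (norm e)\<^sup>2)"
    by (rule real_le_rsqrt)
  also have "\<dots> = contraction_factor \<gamma> \<eta> G * norm e"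
    by (simp add: contraction_factor_def real_sqrt_mult)
  finally show ?thesis
    by (simp add: D_def e_def algebra_simps)
qed

end

text \<open>\<open>sqrt\<close> is negative at negative arguments, so even the lower bound needs
  proof: \<open>\<eta> \<le> G\<close> puts the radicand above the square
  \<open>(1 - \<gamma> * \<eta>)\<^sup>2\<close>.\<close>

lemma contraction_factor_bounds:
  assumes "0 < \<eta>" "\<eta> \<le> G" "0 < \<gamma>" "\<gamma> < 2 / G"
  shows "0 \<le> contraction_factor \<gamma> \<eta> G" "contraction_factor \<gamma> \<eta> G < 1"
proof -
  have "\<gamma>\<^sup>2 * \<eta> * \<eta> \<le> \<gamma>\<^sup>2 * \<eta> * G"
    using assms by (intro mult_left_mono) auto
  then have "(1 - \<gamma> * \<eta>)\<^sup>2 \<le> 1 - \<gamma> * \<eta> * (2 - \<gamma> * G)"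
    by (simp add: power2_eq_square algebra_simps)
  then show "0 \<le> contraction_factor \<gamma> \<eta> G"
    using order_trans[OF zero_le_power2] unfolding contraction_factor_def by (intro real_sqrt_ge_zero)
  have "0 < \<gamma> * \<eta> * (2 - \<gamma> * G)"
    using assms by (auto simp: field_simps)
  then show "contraction_factor \<gamma> \<eta> G < 1"
    by (simp add: contraction_factor_def)
qed

section \<open>First-order optimality and projected steps\<close>

text \<open>A negative directional derivative would make \<open>h\<close> drop below its minimum
  along the segment towards \<open>v\<close>, which stays in \<open>S\<close> by convexity.\<close>

lemma first_order_optimality:
  fixes h :: "'a::real_inner \<Rightarrow> real"
  assumes "convex S" "u \<in> S" "v \<in> S" and min: "\<And>z. z \<in> S \<Longrightarrow> h u \<le> h z"
    and "GDERIV h u :> D"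
  shows "(v - u) \<bullet> D \<ge> 0"
proof (rule ccontr)
  assume "\<not> (v - u) \<bullet> D \<ge> 0"
  moreover have "((\<lambda>s. h (u + s *\<^sub>R (v - u))) has_real_derivative (v - u) \<bullet> D) (at 0)"
    by (rule DERIV_along_line) (simp add: assms)
  ultimately obtain e :: real where e: "e > 0"
    and dec: "\<And>s. s > 0 \<Longrightarrow> s < e \<Longrightarrow> h (u + s *\<^sub>R (v - u)) < h u"
    by (auto dest!: DERIV_neg_dec_right)
  \<comment> \<open>Half of \<open>e\<close> stays strictly inside the interval of decrease; the cap
    at 1 keeps the point on the segment.\<close>
  define s where "s = min (e / 2) 1"
  have s: "s > 0" "s < e" "s \<le> 1" using e by (auto simp: s_def)
  have "u + s *\<^sub>R (v - u) = (1 - s) *\<^sub>R u + s *\<^sub>R v"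
    by (simp add: algebra_simps)
  then have "u + s *\<^sub>R (v - u) \<in> S"
    using convexD[OF assms(1-3), of "1 - s" s] s by simp
  then show False using min dec s by force
qed

text \<open>This lets the learning iterates be compared with the minimizer by nonexpansiveness.
  First-order optimality makes the cross term nonnegative in the squared distance from the gradient
  step to any \<open>z\<close> in \<open>S\<close>, so \<open>u\<close> is nearest.\<close>

lemma closest_point_gradient_step_fixpoint:
  fixes h :: "'a::euclidean_space \<Rightarrow> real"
  assumes "convex S" "closed S" "u \<in> S" and min: "\<And>z. z \<in> S \<Longrightarrow> h u \<le> h z"
    and "GDERIV h u :> D" and "\<gamma> \<ge> 0"
  shows "closest_point S (u - \<gamma> *\<^sub>R D) = u"
proof (rule closest_point_unique[symmetric])
  show "\<forall>z\<in>S. dist (u - \<gamma> *\<^sub>R D) u \<le> dist (u - \<gamma> *\<^sub>R D) z"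
  proof
    fix z assume "z \<in> S"
    then have "0 \<le> \<gamma> * ((z - u) \<bullet> D)"
      using first_order_optimality[OF assms(1,3) _ min assms(5)] assms(6) by simp
    then have "(norm (\<gamma> *\<^sub>R D))\<^sup>2 \<le> (norm (z - u + \<gamma> *\<^sub>R D))\<^sup>2"
      using inner_ge_zero[of "z - u"] unfolding power2_norm_eq_inner
      by (simp add: inner_add inner_diff inner_commute algebra_simps)
    then have "norm (\<gamma> *\<^sub>R D) \<le> norm (z - u + \<gamma> *\<^sub>R D)"
      by (rule power2_le_imp_le) simp
    also have "\<dots> = norm (u - \<gamma> *\<^sub>R D - z)"
      by (subst norm_minus_commute[of _ z]) (simp add: algebra_simps)
    finally show "dist (u - \<gamma> *\<^sub>R D) u \<le> dist (u - \<gamma> *\<^sub>R D) z"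
      by (simp add: dist_norm)
  qed
qed (use assms in auto)

text \<open>Nonexpansiveness towards \<open>y\<close>, expansion of the square and the subgradient
  inequality; for fixed \<open>y\<close> the squared distances telescope over the
  iterations.\<close>

lemma projected_subgradient_step:
  fixes x :: "'a::euclidean_space"
  assumes "convex X" "closed X" "y \<in> X" "d \<in> subdifferential X h x" "norm d \<le> M" "\<gamma> \<ge> 0"
  shows "2 * \<gamma> * (h x - h y)
    \<le> (norm (x - y))\<^sup>2 - (norm (closest_point X (x - \<gamma> *\<^sub>R d) - y))\<^sup>2 + M\<^sup>2 * \<gamma>\<^sup>2"
proof -
  have "norm (closest_point X (x - \<gamma> *\<^sub>R d) - y) \<le> norm (x - \<gamma> *\<^sub>R d - y)"
    using closest_point_lipschitz[OF assms(1,2), of "x - \<gamma> *\<^sub>R d" y] assms(3)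
    by (auto simp: dist_norm closest_point_self)
  then have "(norm (closest_point X (x - \<gamma> *\<^sub>R d) - y))\<^sup>2 \<le> (norm ((x - y) - \<gamma> *\<^sub>R d))\<^sup>2"
    by (intro power_mono) (auto simp: algebra_simps)
  also have "\<dots> = (norm (x - y))\<^sup>2 - 2 * (\<gamma> * (d \<bullet> (x - y))) + (norm d)\<^sup>2 * \<gamma>\<^sup>2"
    unfolding power2_norm_eq_inner
    by (simp add: inner_diff inner_commute power2_eq_square algebra_simps)
  also have "\<dots> \<le> (norm (x - y))\<^sup>2 - 2 * (\<gamma> * (h x - h y)) + M\<^sup>2 * \<gamma>\<^sup>2"
  proof -
    have "h x - h y \<le> d \<bullet> (x - y)"
      using assms(3,4) by (fastforce simp: subdifferential_def inner_diff)
    then have "\<gamma> * (h x - h y) \<le> \<gamma> * (d \<bullet> (x - y))"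
      using assms(6) by (rule mult_left_mono)
    moreover have "(norm d)\<^sup>2 * \<gamma>\<^sup>2 \<le> M\<^sup>2 * \<gamma>\<^sup>2"
      using assms(5) by (intro mult_right_mono power_mono) auto
    ultimately show ?thesis by linarith
  qed
  finally show ?thesis by simp
qed

section \<open>The iterates of the scheme and the convergence of learning\<close>

text \<open>Iterate \<open>k\<close> is produced by the steps before \<open>k\<close>, so the steps
  in \<open>{..<K}\<close> determine everything up to index \<open>K\<close>.\<close>

lemma joint_subgradient_scheme_mem:
  assumes "joint_subgradient_scheme X \<Theta> f g \<gamma>f \<gamma>g {..<K} x \<theta>"
    and "closed X" "closed \<Theta>" and "k \<le> K"
  shows "x k \<in> X" "\<theta> k \<in> \<Theta>"
proof -
  have "x k \<in> X \<and> \<theta> k \<in> \<Theta>"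
    using \<open>k \<le> K\<close>
  proof (induction k)
    case 0
    then show ?case using assms(1) by (simp add: joint_subgradient_scheme_def)
  next
    case (Suc k)
    then have "k \<in> {..<K}" and "X \<noteq> {}" "\<Theta> \<noteq> {}" by auto
    then show ?case
      using assms(1) closest_point_in_set[OF assms(2)] closest_point_in_set[OF assms(3)]
      unfolding joint_subgradient_scheme_def by metis
  qed
  then show "x k \<in> X" "\<theta> k \<in> \<Theta>" by auto
qed

lemma joint_subgradient_scheme_mono:
  assumes "joint_subgradient_scheme X \<Theta> f g \<gamma>f \<gamma>g I x \<theta>" "J \<subseteq> I"
  shows "joint_subgradient_scheme X \<Theta> f g \<gamma>f \<gamma>g J x \<theta>"
  using assms unfolding joint_subgradient_scheme_def by (auto dest: subsetD)

text \<open>Both \<open>\<theta> (Suc k)\<close> and \<open>\<theta>s\<close> are projections of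
  gradient steps, from \<open>\<theta> k\<close> and from \<open>\<theta>s\<close>, so each
  iteration contracts their distance.\<close>

lemma learning_geometric_convergence:
  fixes g :: "'b::euclidean_space \<Rightarrow> real"
  assumes "closed \<Theta>" "convex \<Theta>"
    and diff: "\<And>u. g differentiable (at u)"
    and \<eta>: "0 < \<eta>" and strong: "strongly_convex \<eta> g"
    and lipschitz: "G-lipschitz_on UNIV (gradient g)"
    and \<gamma>: "0 < \<gamma>" "\<gamma> < 2 / G"
    and \<theta>s: "is_arg_min g (\<lambda>t. t \<in> \<Theta>) \<theta>s"
    and scheme: "joint_subgradient_scheme X \<Theta> f g \<gamma>f (\<lambda>_. \<gamma>) {..<K} x \<theta>"
    and "k \<le> K"
  shows "norm (\<theta> k - \<theta>s) \<le> contraction_factor \<gamma> \<eta> G ^ k * norm (\<theta> 0 - \<theta>s)"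
    and "0 \<le> contraction_factor \<gamma> \<eta> G" and "contraction_factor \<gamma> \<eta> G < 1"
proof -
  let ?q = "contraction_factor \<gamma> \<eta> G"
  have mon: "(gradient g u - gradient g v) \<bullet> (u - v) \<ge> \<eta> * (norm (u - v))\<^sup>2" for u v
    using strong by (simp add: strongly_convex_def)
  have lip: "norm (gradient g u - gradient g v) \<le> G * norm (u - v)" for u v
    using lipschitz_onD[OF lipschitz, of u v] by (simp add: dist_norm)
  interpret monotone_lipschitz_gradient g "gradient g" G
  proof
    show "(gradient g u - gradient g v) \<bullet> (u - v) \<ge> 0" for u v
      using mon[of u v] \<eta> by (smt (verit) mult_nonneg_nonneg zero_le_power2)
  qed (rule GDERIV_gradient[OF diff], rule lip)
  have "G \<ge> 0" using lipschitz by (rule lipschitz_on_nonneg)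
  \<comment> \<open>If \<open>G\<close> were 0, then \<open>2 / G\<close> would be 0 by the
    convention for division, leaving no room for \<open>\<gamma>\<close>.\<close>
  moreover have "G \<noteq> 0" using \<gamma> by auto
  ultimately have G: "G > 0" by simp
  \<comment> \<open>Strong monotonicity and the Lipschitz bound are compared at a unit vector and
    the origin.\<close>
  have "\<eta> \<le> G"
  proof -
    obtain b :: 'b where b: "norm b = 1" using vector_choose_size[of 1] by auto
    have "\<eta> \<le> (gradient g b - gradient g 0) \<bullet> b" using mon[of b 0] b by simp
    also have "\<dots> \<le> norm (gradient g b - gradient g 0) * norm b" by (rule norm_cauchy_schwarz)
    also have "\<dots> \<le> G" using lip[of b 0] b by simp
    finally show ?thesis .
  qed
  then show q: "0 \<le> ?q" "?q < 1"
    using contraction_factor_bounds \<eta> \<gamma> by blast+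
  have mem: "\<theta>s \<in> \<Theta>" and min: "\<And>z. z \<in> \<Theta> \<Longrightarrow> g \<theta>s \<le> g z"
    using \<theta>s by (auto simp: is_arg_min_linorder)
  have fp: "closest_point \<Theta> (\<theta>s - \<gamma> *\<^sub>R gradient g \<theta>s) = \<theta>s"
    using closest_point_gradient_step_fixpoint[OF assms(2,1) mem min grad] \<gamma> by simp
  show "norm (\<theta> k - \<theta>s) \<le> ?q ^ k * norm (\<theta> 0 - \<theta>s)"
    using \<open>k \<le> K\<close>
  proof (induction k)
    case (Suc k)
    have "\<theta> (Suc k) = closest_point \<Theta> (\<theta> k - \<gamma> *\<^sub>R gradient g (\<theta> k))"
      using scheme Suc.prems by (auto simp: joint_subgradient_scheme_def)
    then have "norm (\<theta> (Suc k) - \<theta>s)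
        \<le> norm ((\<theta> k - \<gamma> *\<^sub>R gradient g (\<theta> k)) - (\<theta>s - \<gamma> *\<^sub>R gradient g \<theta>s))"
      using closest_point_lipschitz[OF assms(2,1), of "\<theta> k - \<gamma> *\<^sub>R gradient g (\<theta> k)"
          "\<theta>s - \<gamma> *\<^sub>R gradient g \<theta>s"] mem fp by (auto simp: dist_norm)
    also have "\<dots> \<le> ?q * norm (\<theta> k - \<theta>s)"
      by (rule gradient_step_contraction[OF G \<gamma> mon])
    also have "\<dots> \<le> ?q * (?q ^ k * norm (\<theta> 0 - \<theta>s))"
      using Suc q by (intro mult_left_mono) auto
    finally show ?case by (simp add: mult_ac)
  qed simp
qed

section \<open>The error of the averaged iterate\<close>

text \<open>The first term pays for evaluating at \<open>\<theta> K\<close> instead of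
  \<open>\<theta>s\<close>; the quotient bounds the optimality gap of the average for the true
  parameter. No particular steplength rule is fixed, so both claims of the theorem can draw on
  it.\<close>

lemma averaged_error_bound:
  fixes X :: "'a::euclidean_space set" and \<Theta> :: "'b::euclidean_space set"
  assumes "closed X" "convex X" "closed \<Theta>"
    and convex: "convex_on X (\<lambda>y. f y \<theta>s)"
    and lipschitz: "\<forall>y\<in>X. \<forall>t\<in>\<Theta>. \<bar>f y t - f y \<theta>s\<bar> \<le> L * norm (t - \<theta>s)"
    and xs: "is_arg_min (\<lambda>y. f y \<theta>s) (\<lambda>y. y \<in> X) xs"
    and scheme: "joint_subgradient_scheme X \<Theta> f g \<gamma>f \<gamma>g {..K} x \<theta>"
    and bounded: "\<And>k d. k \<le> K \<Longrightarrow> d \<in> subdifferential X (\<lambda>y. f y (\<theta> k)) (x k) \<Longrightarrow> norm d \<le> M"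
    and \<gamma>f: "\<And>k. k \<le> K \<Longrightarrow> \<gamma>f k \<ge> 0" and pos: "(\<Sum>i\<le>K. \<gamma>f i) > 0"
  shows "\<bar>f (weighted_average \<gamma>f x K) (\<theta> K) - f xs \<theta>s\<bar> \<le> L * norm (\<theta> K - \<theta>s) +
    ((norm (x 0 - xs))\<^sup>2 + M\<^sup>2 * (\<Sum>i\<le>K. (\<gamma>f i)\<^sup>2)
      + 4 * (\<Sum>i\<le>K. \<gamma>f i * (L * norm (\<theta> i - \<theta>s)))) / (2 * (\<Sum>i\<le>K. \<gamma>f i))"
proof -
  let ?S = "\<Sum>i\<le>K. \<gamma>f i" and ?xb = "weighted_average \<gamma>f x K"
  let ?gap = "\<lambda>y. f y \<theta>s - f xs \<theta>s"
  have mem: "x k \<in> X" "\<theta> k \<in> \<Theta>" if "k \<le> K" for k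
    by (rule joint_subgradient_scheme_mem[OF joint_subgradient_scheme_mono[OF scheme] assms(1,3) that];
        auto)+
  have xs_mem: "xs \<in> X" and gap_nonneg: "\<And>y. y \<in> X \<Longrightarrow> ?gap y \<ge> 0"
    using xs by (auto simp: is_arg_min_linorder)
  have step: "2 * (\<gamma>f i * ?gap (x i)) \<le> (norm (x i - xs))\<^sup>2 - (norm (x (Suc i) - xs))\<^sup>2
      + M\<^sup>2 * (\<gamma>f i)\<^sup>2 + 4 * (\<gamma>f i * (L * norm (\<theta> i - \<theta>s)))" if i: "i \<le> K" for i
  proof -
    obtain d where d: "d \<in> subdifferential X (\<lambda>y. f y (\<theta> i)) (x i)"
      and next_x: "x (Suc i) = closest_point X (x i - \<gamma>f i *\<^sub>R d)"
      using scheme i by (auto simp: joint_subgradient_scheme_def)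
    \<comment> \<open>The parameter is exchanged at two points, \<open>x i\<close> and
      \<open>xs\<close>. With the factor 2 of the projected step this gives the constant 4.\<close>
    have "?gap (x i) \<le> f (x i) (\<theta> i) - f xs (\<theta> i) + 2 * (L * norm (\<theta> i - \<theta>s))"
      using lipschitz[rule_format, OF mem(1)[OF i] mem(2)[OF i]]
        lipschitz[rule_format, OF xs_mem mem(2)[OF i]]
      by linarith
    then have "\<gamma>f i * ?gap (x i)
        \<le> \<gamma>f i * (f (x i) (\<theta> i) - f xs (\<theta> i) + 2 * (L * norm (\<theta> i - \<theta>s)))"
      using \<gamma>f[OF i] by (rule mult_left_mono)
    then show ?thesis
      using projected_subgradient_step[OF assms(2,1) xs_mem d bounded[OF i d] \<gamma>f[OF i]]
      unfolding next_x by (simp add: algebra_simps)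
  qed
  let ?N = "(norm (x 0 - xs))\<^sup>2 + M\<^sup>2 * (\<Sum>i\<le>K. (\<gamma>f i)\<^sup>2)
      + 4 * (\<Sum>i\<le>K. \<gamma>f i * (L * norm (\<theta> i - \<theta>s)))"
  have "2 * (\<Sum>i\<le>K. \<gamma>f i * ?gap (x i)) \<le> (\<Sum>i\<le>K. (norm (x i - xs))\<^sup>2 - (norm (x (Suc i) - xs))\<^sup>2
      + M\<^sup>2 * (\<gamma>f i)\<^sup>2 + 4 * (\<gamma>f i * (L * norm (\<theta> i - \<theta>s))))"
    unfolding sum_distrib_left using step by (intro sum_mono) auto
  also have "\<dots> = (norm (x 0 - xs))\<^sup>2 - (norm (x (Suc K) - xs))\<^sup>2 + M\<^sup>2 * (\<Sum>i\<le>K. (\<gamma>f i)\<^sup>2)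
      + 4 * (\<Sum>i\<le>K. \<gamma>f i * (L * norm (\<theta> i - \<theta>s)))"
    using sum_telescope[of "\<lambda>i. (norm (x i - xs))\<^sup>2" K]
    by (simp add: sum.distrib flip: sum_distrib_left)
  also have "\<dots> \<le> ?N" by simp
  finally have telescoped: "2 * (\<Sum>i\<le>K. \<gamma>f i * ?gap (x i)) \<le> ?N" .
  \<comment> \<open>Written as a convex combination, the average stays in \<open>X\<close> and
    Jensen's inequality applies.\<close>
  have avg: "?xb = (\<Sum>i\<le>K. (\<gamma>f i / ?S) *\<^sub>R x i)"
    by (simp add: weighted_average_def scaleR_sum_right divide_inverse mult_ac)
  have weights: "(\<Sum>i\<le>K. \<gamma>f i / ?S) = 1"
    using pos by (simp flip: sum_divide_distrib)
  have xb: "?xb \<in> X"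
    unfolding avg using mem \<gamma>f pos weights assms(2) by (intro convex_sum) auto
  have "f ?xb \<theta>s \<le> (\<Sum>i\<le>K. \<gamma>f i / ?S * f (x i) \<theta>s)"
    unfolding avg using mem \<gamma>f pos weights convex by (intro convex_on_sum) auto
  also have "\<dots> = (\<Sum>i\<le>K. \<gamma>f i * f (x i) \<theta>s) / ?S"
    by (simp add: sum_divide_distrib)
  finally have "?gap ?xb \<le> (\<Sum>i\<le>K. \<gamma>f i * ?gap (x i)) / ?S"
    using pos by (simp add: right_diff_distrib sum_subtractf diff_divide_distrib flip: sum_distrib_right)
  also have "\<dots> \<le> ?N / (2 * ?S)"
    using telescoped pos by (simp add: field_simps)
  finally have "?gap ?xb \<le> ?N / (2 * ?S)" .
  \<comment> \<open>Minimality of \<open>xs\<close> makes the gap of the average nonnegative, so its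
    upper bound also bounds its absolute value.\<close>
  then show ?thesis
    using lipschitz[rule_format, OF xb mem(2)[OF order_refl]] gap_nonneg[OF xb] by linarith
qed

section \<open>Diminishing and constant steplengths\<close>

lemma sum_geometric_le:
  fixes q :: real
  assumes "0 \<le> q" "q < 1"
  shows "(\<Sum>i\<le>n. q ^ i) \<le> 1 / (1 - q)"
  using sum_le_suminf[OF summable_geometric, of q "{..n}"] assms by (simp add: suminf_geometric)

theorem proposition14:
  fixes X :: "(real^'n) set" and \<Theta> :: "(real^'m) set"
    and f :: "real^'n \<Rightarrow> real^'m \<Rightarrow> real" and g :: "real^'m \<Rightarrow> real"
    and x :: "nat \<Rightarrow> real^'n" and \<theta> :: "nat \<Rightarrow> real^'m"
    and \<gamma>f :: "nat \<Rightarrow> real" and \<gamma>g \<eta>g Gg L M :: real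
    and xs :: "real^'n" and \<theta>s :: "real^'m"
  assumes "X \<noteq> {}" and "closed X" and "convex X"
    and "\<Theta> \<noteq> {}" and "closed \<Theta>" and "convex \<Theta>"
    and f_convex: "\<And>t. t \<in> \<Theta> \<Longrightarrow> convex_on X (\<lambda>y. f y t)"
    and g_convex: "convex_on UNIV g"
    and g_C1: "continuously_differentiable g"
    and "\<eta>g > 0" and g_strong: "strongly_convex \<eta>g g"
    and g_lipschitz: "Gg-lipschitz_on UNIV (gradient g)"
    and f_lipschitz: "\<And>y t1 t2. y \<in> X \<Longrightarrow> t1 \<in> \<Theta> \<Longrightarrow> t2 \<in> \<Theta> \<Longrightarrow>
                        \<bar>f y t1 - f y t2\<bar> \<le> L * norm (t1 - t2)"
    and "0 < \<gamma>g" and "\<gamma>g < 2 / Gg"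
    and "M > 0"
    and \<theta>s: "is_arg_min g (\<lambda>t. t \<in> \<Theta>) \<theta>s"
    and xs: "is_arg_min (\<lambda>y. f y \<theta>s) (\<lambda>y. y \<in> X) xs"
  shows
    "(joint_subgradient_scheme X \<Theta> f g \<gamma>f (\<lambda>_. \<gamma>g) UNIV x \<theta> \<and>
      (\<forall>k. \<forall>d \<in> subdifferential X (\<lambda>y. f y (\<theta> k)) (x k). norm d \<le> M) \<and>
      (\<forall>k. \<gamma>f k \<ge> 0) \<and> \<gamma>f \<longlonglongrightarrow> 0 \<and>
      filterlim (\<lambda>n. \<Sum>k=1..n. \<gamma>f k) at_top sequentially \<and>
      summable (\<lambda>k. (\<gamma>f (Suc k))\<^sup>2)
      \<longrightarrow> (\<lambda>k. \<bar>f (weighted_average \<gamma>f x k) (\<theta> k) - f xs \<theta>s\<bar>) \<longlonglongrightarrow> 0)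
   \<and> (\<forall>K.
      joint_subgradient_scheme X \<Theta> f g \<gamma>f (\<lambda>_. \<gamma>g) {..K} x \<theta> \<and>
      (\<forall>k\<le>K. \<forall>d \<in> subdifferential X (\<lambda>y. f y (\<theta> k)) (x k). norm d \<le> M) \<and>
      (\<forall>k\<le>K. \<gamma>f k = norm (x 0 - xs) / (M * sqrt (real K + 1))) \<and>
      (\<Sum>i\<le>K. \<gamma>f i) > 0
      \<longrightarrow> (let q = contraction_factor \<gamma>g \<eta>g Gg;
               d_x = M * norm (x 0 - xs);
               c\<theta> = 2 * L / (1 - q)
           in \<bar>f (weighted_average \<gamma>f x K) (\<theta> K) - f xs \<theta>s\<bar>
                \<le> d_x / sqrt (real K + 1)
                   + norm (\<theta> 0 - \<theta>s) * (L * q ^ K + c\<theta> / (real K + 1))))"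
proof (intro conjI allI impI)
  let ?q = "contraction_factor \<gamma>g \<eta>g Gg"
  have diff: "\<And>u. g differentiable (at u)"
    using g_C1 by (simp add: continuously_differentiable_def)
  have \<theta>s_mem: "\<theta>s \<in> \<Theta>" and xs_mem: "xs \<in> X"
    using \<theta>s xs by (auto simp: is_arg_min_def)
  have f_lip: "\<forall>y\<in>X. \<forall>t\<in>\<Theta>. \<bar>f y t - f y \<theta>s\<bar> \<le> L * norm (t - \<theta>s)"
    using f_lipschitz \<theta>s_mem by blast
  note learning = learning_geometric_convergence[OF \<open>closed \<Theta>\<close> \<open>convex \<Theta>\<close> diff \<open>\<eta>g > 0\<close>
      g_strong g_lipschitz \<open>0 < \<gamma>g\<close> \<open>\<gamma>g < 2 / Gg\<close> \<theta>s]
  note error = averaged_error_bound[OF \<open>closed X\<close> \<open>convex X\<close> \<open>closed \<Theta>\<close> f_convex[OF \<theta>s_mem]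
      f_lip xs]
  have scaled: "L * norm (\<theta> k - \<theta>s) \<le> L * norm (\<theta> 0 - \<theta>s) * ?q ^ k"
      "0 \<le> L * norm (\<theta> 0 - \<theta>s)" "0 \<le> ?q" "?q < 1"
    if scheme: "joint_subgradient_scheme X \<Theta> f g \<gamma>f (\<lambda>_. \<gamma>g) {..K} x \<theta>" and "k \<le> K" for k K
  proof -
    have lt: "joint_subgradient_scheme X \<Theta> f g \<gamma>f (\<lambda>_. \<gamma>g) {..<K} x \<theta>"
      using scheme by (rule joint_subgradient_scheme_mono) auto
    note geo = learning[OF lt \<open>k \<le> K\<close>]
    show "0 \<le> ?q" "?q < 1" using geo by auto
    \<comment> \<open>The sign of \<open>L\<close> is not prescribed. The Lipschitz condition itself
      makes these products nonnegative, so a negative \<open>L\<close> forces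
      \<open>\<theta> i = \<theta>s\<close> for all \<open>i \<le> K\<close>, and the claim becomes
      \<open>0 \<le> 0\<close>.\<close>
    have nn: "0 \<le> L * norm (\<theta> i - \<theta>s)" if "i \<le> K" for i
      using f_lipschitz[OF xs_mem joint_subgradient_scheme_mem(2)[OF lt \<open>closed X\<close> \<open>closed \<Theta>\<close> that]
          \<theta>s_mem] by linarith
    show "0 \<le> L * norm (\<theta> 0 - \<theta>s)" using nn by simp
    show "L * norm (\<theta> k - \<theta>s) \<le> L * norm (\<theta> 0 - \<theta>s) * ?q ^ k"
    proof (cases "L \<ge> 0")
      case True
      then show ?thesis using mult_left_mono[OF geo(1)] by (simp add: mult_ac)
    next
      case False
      then have "\<theta> i = \<theta>s" if "i \<le> K" for i
        using nn[OF that] by (auto simp: zero_le_mult_iff)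
      then show ?thesis using \<open>k \<le> K\<close> by simp
    qed
  qed
  {
    assume H: "joint_subgradient_scheme X \<Theta> f g \<gamma>f (\<lambda>_. \<gamma>g) UNIV x \<theta> \<and>
      (\<forall>k. \<forall>d \<in> subdifferential X (\<lambda>y. f y (\<theta> k)) (x k). norm d \<le> M) \<and>
      (\<forall>k. \<gamma>f k \<ge> 0) \<and> \<gamma>f \<longlonglongrightarrow> 0 \<and>
      filterlim (\<lambda>n. \<Sum>k=1..n. \<gamma>f k) at_top sequentially \<and>
      summable (\<lambda>k. (\<gamma>f (Suc k))\<^sup>2)"
    then have scheme: "joint_subgradient_scheme X \<Theta> f g \<gamma>f (\<lambda>_. \<gamma>g) {..K} x \<theta>" for K
      using joint_subgradient_scheme_mono by blast
    have \<gamma>f: "\<gamma>f k \<ge> 0" for k using H by blast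
    define R where "R = L * norm (\<theta> 0 - \<theta>s)"
    note geo = scaled[OF scheme order_refl, folded R_def]
    \<comment> \<open>A uniform bound \<open>B\<close> on the steplengths reduces the weighted
      learning errors to a geometric series.\<close>
    have "Bseq \<gamma>f" using H by (blast intro: convergent_imp_Bseq convergentI)
    then obtain B where B: "\<And>k. \<gamma>f k \<le> B"
      by (auto simp: Bseq_def) (meson abs_le_D1)
    \<comment> \<open>The hypothesis sums from index 1, whereas the averages start at index
      0.\<close>
    have sq: "summable (\<lambda>k. (\<gamma>f k)\<^sup>2)"
      using H summable_Suc_iff[of "\<lambda>k. (\<gamma>f k)\<^sup>2"] by blast
    \<comment> \<open>\<open>C\<close> dominates the numerator of the error bound for every
      \<open>K\<close>: full series replace the partial sums.\<close>
    define C where "C = (norm (x 0 - xs))\<^sup>2 + M\<^sup>2 * (\<Sum>i. (\<gamma>f i)\<^sup>2) + 4 * (B * (R * (1 / (1 - ?q))))"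
    let ?S = "\<lambda>K. \<Sum>i\<le>K. \<gamma>f i"
    have S_top: "filterlim ?S at_top sequentially"
    proof (rule filterlim_at_top_mono)
      show "filterlim (\<lambda>n. \<Sum>k=1..n. \<gamma>f k) at_top sequentially" using H by blast
      show "\<forall>\<^sub>F K in sequentially. (\<Sum>k=1..K. \<gamma>f k) \<le> ?S K"
        using \<gamma>f by (intro always_eventually allI sum_mono2) auto
    qed
    have bound: "\<bar>f (weighted_average \<gamma>f x K) (\<theta> K) - f xs \<theta>s\<bar> \<le> R * ?q ^ K + C / (2 * ?S K)"
      if pos: "?S K > 0" for K
    proof -
      have "(\<Sum>i\<le>K. \<gamma>f i * (L * norm (\<theta> i - \<theta>s))) \<le> (\<Sum>i\<le>K. B * (R * ?q ^ i))"
        using geo \<gamma>f B by (intro sum_mono mult_mono' order_trans[OF mult_left_mono[OF geo(1)]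
          mult_right_mono[OF B]]) auto
      also have "\<dots> = B * (R * (\<Sum>i\<le>K. ?q ^ i))"
        by (simp add: sum_distrib_left)
      also have "\<dots> \<le> B * (R * (1 / (1 - ?q)))"
        using geo order_trans[OF \<gamma>f B] by (intro mult_left_mono sum_geometric_le) auto
      finally have "(norm (x 0 - xs))\<^sup>2 + M\<^sup>2 * (\<Sum>i\<le>K. (\<gamma>f i)\<^sup>2)
          + 4 * (\<Sum>i\<le>K. \<gamma>f i * (L * norm (\<theta> i - \<theta>s))) \<le> C"
        unfolding C_def using sq by (intro add_mono mult_left_mono sum_le_suminf) auto
      then have "((norm (x 0 - xs))\<^sup>2 + M\<^sup>2 * (\<Sum>i\<le>K. (\<gamma>f i)\<^sup>2)
          + 4 * (\<Sum>i\<le>K. \<gamma>f i * (L * norm (\<theta> i - \<theta>s)))) / (2 * ?S K) \<le> C / (2 * ?S K)"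
        using pos by (intro divide_right_mono) auto
      moreover note geo(1)[of K] error[OF scheme, of K M]
      ultimately show ?thesis using H pos by force
    qed
    have "filterlim (\<lambda>K. 2 * ?S K) at_top sequentially"
      by (rule filterlim_tendsto_pos_mult_at_top[OF tendsto_const _ S_top]) simp
    then have "(\<lambda>K. inverse (2 * ?S K)) \<longlonglongrightarrow> 0"
      by (rule tendsto_inverse_0_at_top)
    moreover have "(\<lambda>K. ?q ^ K) \<longlonglongrightarrow> 0"
      using geo(3,4) by (rule LIMSEQ_realpow_zero)
    ultimately have "(\<lambda>K. R * ?q ^ K + C * inverse (2 * ?S K)) \<longlonglongrightarrow> R * 0 + C * 0"
      by (intro tendsto_add tendsto_mult_left)
    then have lim: "(\<lambda>K. R * ?q ^ K + C / (2 * ?S K)) \<longlonglongrightarrow> 0"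
      by (simp only: divide_inverse mult_zero_right add_0)
    show "(\<lambda>k. \<bar>f (weighted_average \<gamma>f x k) (\<theta> k) - f xs \<theta>s\<bar>) \<longlonglongrightarrow> 0"
    proof (rule real_tendsto_sandwich[OF _ _ tendsto_const lim])
      \<comment> \<open>Initial steplengths may vanish and leave the average at its junk value;
        divergence makes the weight sum positive, and \<open>bound\<close> applicable, for all large
        \<open>K\<close>.\<close>
      show "\<forall>\<^sub>F K in sequentially. \<bar>f (weighted_average \<gamma>f x K) (\<theta> K) - f xs \<theta>s\<bar>
          \<le> R * ?q ^ K + C / (2 * ?S K)"
        using S_top unfolding filterlim_at_top_dense by (blast intro: eventually_mono bound)
    qed auto
  }
  fix K
  assume H: "joint_subgradient_scheme X \<Theta> f g \<gamma>f (\<lambda>_. \<gamma>g) {..K} x \<theta> \<and>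
      (\<forall>k\<le>K. \<forall>d \<in> subdifferential X (\<lambda>y. f y (\<theta> k)) (x k). norm d \<le> M) \<and>
      (\<forall>k\<le>K. \<gamma>f k = norm (x 0 - xs) / (M * sqrt (real K + 1))) \<and>
      (\<Sum>i\<le>K. \<gamma>f i) > 0"
  then have scheme: "joint_subgradient_scheme X \<Theta> f g \<gamma>f (\<lambda>_. \<gamma>g) {..K} x \<theta>" by blast
  define R where "R = L * norm (\<theta> 0 - \<theta>s)"
  note geo = scaled[OF scheme, folded R_def]
  define r D where "r = sqrt (real K + 1)" and "D = norm (x 0 - xs)"
  define c where "c = D / (M * r)"
  have r: "r > 0" "r\<^sup>2 = real K + 1" by (auto simp: r_def)
  have \<gamma>f: "\<gamma>f k = c" if "k \<le> K" for k
    using H that by (simp add: c_def r_def D_def)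
  have S: "(\<Sum>i\<le>K. \<gamma>f i) = r\<^sup>2 * c" using \<gamma>f r by simp
  \<comment> \<open>A positive weight sum excludes \<open>x 0 = xs\<close>, where the prescribed
    steplength would be 0.\<close>
  then have c: "c > 0" using H r by (auto simp: zero_less_mult_iff)
  have "(\<Sum>i\<le>K. L * norm (\<theta> i - \<theta>s)) \<le> (\<Sum>i\<le>K. R * ?q ^ i)"
    using geo(1) by (intro sum_mono) auto
  also have "\<dots> = R * (\<Sum>i\<le>K. ?q ^ i)" by (simp add: sum_distrib_left)
  also have "\<dots> \<le> R * (1 / (1 - ?q))"
    using geo by (intro mult_left_mono sum_geometric_le) auto
  finally have E: "(\<Sum>i\<le>K. L * norm (\<theta> i - \<theta>s)) \<le> R / (1 - ?q)" by simp
  have sq: "(\<Sum>i\<le>K. (\<gamma>f i)\<^sup>2) = r\<^sup>2 * c\<^sup>2" using \<gamma>f r by simp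
  have Es: "(\<Sum>i\<le>K. \<gamma>f i * (L * norm (\<theta> i - \<theta>s))) = c * (\<Sum>i\<le>K. L * norm (\<theta> i - \<theta>s))"
    using \<gamma>f by (simp add: sum_distrib_left)
  \<comment> \<open>The steplength balances the bound: \<open>D\<^sup>2\<close> equals
    \<open>M\<^sup>2 * (r\<^sup>2 * c\<^sup>2)\<close>, and each contributes half of
    \<open>M * D / r\<close>.\<close>
  have Dc: "D = c * M * r" using r \<open>M > 0\<close> by (simp add: c_def)
  have "\<bar>f (weighted_average \<gamma>f x K) (\<theta> K) - f xs \<theta>s\<bar> \<le> L * norm (\<theta> K - \<theta>s) +
    (D\<^sup>2 + M\<^sup>2 * (r\<^sup>2 * c\<^sup>2) + 4 * (c * (\<Sum>i\<le>K. L * norm (\<theta> i - \<theta>s)))) / (2 * (r\<^sup>2 * c))"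
    using error[OF scheme, of M] H \<gamma>f c unfolding sq Es S D_def by auto
  also have "\<dots> \<le> R * ?q ^ K + (D\<^sup>2 + M\<^sup>2 * (r\<^sup>2 * c\<^sup>2) + 4 * (c * (R / (1 - ?q)))) / (2 * (r\<^sup>2 * c))"
    using E c r geo(1)[of K] by (intro add_mono divide_right_mono mult_left_mono) auto
  \<comment> \<open>In the learning term \<open>c\<close> cancels; since
    \<open>r\<^sup>2 = real K + 1\<close>, what remains is
    \<open>norm (\<theta> 0 - \<theta>s)\<close> times
    \<open>c\<theta> / (real K + 1)\<close>.\<close>
  also have "(D\<^sup>2 + M\<^sup>2 * (r\<^sup>2 * c\<^sup>2) + 4 * (c * (R / (1 - ?q)))) / (2 * (r\<^sup>2 * c))
      = M * D / r + 2 * (R / (1 - ?q)) / r\<^sup>2"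
    unfolding Dc using r(1) c geo(4)[OF order_refl] by (simp add: field_simps power2_eq_square)
  finally show "let q = ?q; d_x = M * norm (x 0 - xs); c\<theta> = 2 * L / (1 - q)
           in \<bar>f (weighted_average \<gamma>f x K) (\<theta> K) - f xs \<theta>s\<bar>
                \<le> d_x / sqrt (real K + 1)
                   + norm (\<theta> 0 - \<theta>s) * (L * q ^ K + c\<theta> / (real K + 1))"
    using r(1) unfolding Let_def r_def[symmetric] D_def[symmetric] r(2)[symmetric] R_def
    by (simp add: algebra_simps)
qed

end
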